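(* (i) Assume that $Q$ is compact and that for each stationary controller policy $\Delta:S\to Q$ there exists $p\in\mathcal{P}$ such that the Markov kernel $p_\Delta$ is irreducible. Then the constant-gain robust Bellman equation $$u^*(s)=\sup_{\phi\in Q}\inf_{p_s\in\mathcal{P}_s}\sum_{a\in A}\sum_{s'\in S}\phi(a)p_s(s'|a)\big[r(s,a)-\alpha^*+u^*(s')\big]\qquad\forall s\in S$$ has a solution $(u^*,\alpha^* )$ with $u^*:S\to\mathbb{R}$, $\alpha^*\in[0,1]$. (ii) Assume that $\mathcal{P}_s$, $s\in S$, are compact and that for each $p\in\mathcal{P}$ there exists $\Delta:S\to Q$ such that $p_\Delta$ is irreducible. Then the constant-gain inf-sup equation $$u'(s)=\inf_{p_s\in\mathcal{P}_s}\sup_{\phi\in Q}\sum_{a\in A}\sum_{s'\in S}\phi(a)p_s(s'|a)\big[r(s,a)-\alpha'+u'(s')\big]\qquad\forall s\in S$$ has a solution $(u',\alpha')$ with $u':S\to\mathbb{R}$, $\alpha'\in[0,1]$.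
   Context: $S$ (states) and $A$ (actions) are finite nonempty sets; $\mathrm{Prob}(E)$ is the set of probability distributions on a finite set $E$; $r:S\times A\to[0,1]$ is a reward function. $Q\subseteq\mathrm{Prob}(A)$ is nonempty. For each $s\in S$, $\mathcal{P}_s$ is a nonempty set of maps $p_s:A\to\mathrm{Prob}(S)$, written $p_s(s'|a)$; $\mathcal{P}=\prod_{s\in S}\mathcal{P}_s$, and $p\in\mathcal{P}$ is written $p(s'|s,a)=p_s(s'|a)$. Compactness is in the Euclidean topology. For $p\in\mathcal{P}$ and $\Delta:S\to Q$ (written $\Delta(a|s)$), $p_\Delta(s'|s)=\sum_{a\in A}p(s'|s,a)\Delta(a|s)$. *)

theory Defs
  imports "HOL-Analysis.Analysis"
begin

text \<open>
  States and actions are the elements of finite types, and distributions on such a type are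
  vectors, so that \<open>compact\<close> refers to the Euclidean topology.  A map from actions
  to distributions on states is a vector of vectors, \<open>p $ a $ s'\<close> standing for
  \<open>p(s'|a)\<close>.
\<close>

definition Prob :: "(real ^ 'e::finite) set" where
  "Prob = {d. (\<forall>i. 0 \<le> d $ i) \<and> (\<Sum>i\<in>UNIV. d $ i) = 1}"

definition policy_kernel ::
  "('s \<Rightarrow> real ^ 's ^ 'a) \<Rightarrow> ('s \<Rightarrow> real ^ 'a) \<Rightarrow> real ^ 's ^ 's::finite" where
  "policy_kernel p \<Delta> = (\<chi> s s'. \<Sum>a\<in>UNIV. p s $ a $ s' * \<Delta> s $ a)"

text \<open>
  The function power is used because \<open>^\<close> on this type would be the componentwise power.
\<close>

definition kernel_power :: "real ^ 's ^ 's \<Rightarrow> nat \<Rightarrow> real ^ 's ^ 's::finite" where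
  "kernel_power K n = (((**) K) ^^ n) (mat 1)"

definition irreducible_kernel :: "real ^ 's ^ 's::finite \<Rightarrow> bool" where
  "irreducible_kernel K \<longleftrightarrow> (\<forall>s s'. \<exists>n\<ge>1. kernel_power K n $ s $ s' > 0)"

definition bellman_term ::
  "('s \<Rightarrow> 'a \<Rightarrow> real) \<Rightarrow> real \<Rightarrow> ('s \<Rightarrow> real) \<Rightarrow> 's \<Rightarrow> real ^ 'a \<Rightarrow> real ^ 's ^ 'a \<Rightarrow> real" where
  "bellman_term r \<alpha> u s \<phi> q =
     (\<Sum>a\<in>UNIV. \<Sum>s'\<in>UNIV. \<phi> $ a * q $ a $ s' * (r s a - \<alpha> + u s'))"

text \<open>
  The suprema and infima below are taken in the reals.  They are genuine for nonempty sets of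
  distributions \<open>Q\<close>, \<open>P s\<close>, where the term above is bounded uniformly in
  \<open>\<phi>\<close> and \<open>q\<close>.
\<close>

definition sup_inf_solution ::
  "(real ^ 'a) set \<Rightarrow> ('s \<Rightarrow> (real ^ 's ^ 'a) set) \<Rightarrow> ('s \<Rightarrow> 'a \<Rightarrow> real) \<Rightarrow>
   ('s \<Rightarrow> real) \<Rightarrow> real \<Rightarrow> bool" where
  "sup_inf_solution Q P r u \<alpha> \<longleftrightarrow>
     (\<forall>s. u s = (SUP \<phi>\<in>Q. INF q\<in>P s. bellman_term r \<alpha> u s \<phi> q))"

definition inf_sup_solution ::
  "(real ^ 'a) set \<Rightarrow> ('s \<Rightarrow> (real ^ 's ^ 'a) set) \<Rightarrow> ('s \<Rightarrow> 'a \<Rightarrow> real) \<Rightarrow>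
   ('s \<Rightarrow> real) \<Rightarrow> real \<Rightarrow> bool" where
  "inf_sup_solution Q P r u \<alpha> \<longleftrightarrow>
     (\<forall>s. u s = (INF q\<in>P s. SUP \<phi>\<in>Q. bellman_term r \<alpha> u s \<phi> q))"

end

theory Submission
  imports Defs
begin

text \<open>
  Both equations are instances of one statement about a game in which the outer player chooses
  \<open>x\<close> in a compact set, the inner player answers with \<open>y\<close>, and an outer policy
  always admits an inner policy making the resulting chain irreducible.  In (i) the outer player is
  the controller, who maximises; in (ii) it is nature, who minimises.  Negating values and replacing
  \<open>r\<close> by \<open>1 - r\<close> turns the second case into the first.

  Let \<open>T u\<close> be the sup-inf of stage reward plus expected \<open>u\<close>.  The equation asks
  for an additive eigenvector, \<open>T u = u + \<alpha>\<close>.  The operator \<open>T\<close> is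
  nonexpansive in the maximum norm, so for any cap \<open>C > 0\<close> the map
  \<open>u \<mapsto> min (T u - min T u) C\<close> is a continuous self-map of the cube
  \<open>[0, C]\<close> and Brouwer's theorem gives a fixed point.  If the cap is inactive at that point,
  the fixed point is an eigenvector with eigenvalue \<open>min T u\<close>.

  The cap is inactive once \<open>C\<close> exceeds an a priori bound on oscillations.  A fixed point
  satisfies \<open>u \<le> T u\<close>, so some outer policy, chosen near-optimally in every state,
  gives \<open>u \<le> 2 + K u\<close> for the kernel \<open>K\<close> of every inner reply.  Choose the reply
  that makes \<open>K\<close> irreducible.  Where \<open>u\<close> is not far below its maximum, neither is
  the average of \<open>u\<close> over the successors, so every successor of probability at least
  \<open>\<delta>\<close> has a value not far below the maximum; following paths of \<open>K\<close> from the
  maximum to the minimum bounds the oscillation (\<open>oscillation_bound_irreducible\<close>).  With the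
  reply held fixed, the same paths keep a probability bounded below when the outer policy moves
  slightly, so the bound is locally uniform in that policy, and compactness makes it uniform
  (\<open>uniform_oscillation_bound\<close>).
\<close>

section \<open>Sup-inf values\<close>

definition maxmin :: "'x set \<Rightarrow> 'y set \<Rightarrow> ('x \<Rightarrow> 'y \<Rightarrow> real) \<Rightarrow> real" where
  "maxmin X Y F = (SUP x\<in>X. INF y\<in>Y. F x y)"

lemma maxmin_le_add:
  assumes "X \<noteq> {}" "Y \<noteq> {}"
    and lower: "\<And>x y. x \<in> X \<Longrightarrow> y \<in> Y \<Longrightarrow> a \<le> F x y"
    and upper: "\<And>x y. x \<in> X \<Longrightarrow> y \<in> Y \<Longrightarrow> G x y \<le> b"
    and le: "\<And>x y. x \<in> X \<Longrightarrow> y \<in> Y \<Longrightarrow> F x y \<le> G x y + d"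
  shows "maxmin X Y F \<le> maxmin X Y G + d"
proof -
  obtain y0 where y0: "y0 \<in> Y" using \<open>Y \<noteq> {}\<close> by blast
  have bddF: "bdd_below (F x ` Y)" if "x \<in> X" for x
    using lower[OF that] by (auto intro!: bdd_belowI2[where m = a])
  have "a - d \<le> G x y" if "x \<in> X" "y \<in> Y" for x y
    using lower[OF that] le[OF that] by linarith
  then have bddG: "bdd_below (G x ` Y)" if "x \<in> X" for x
    using that by (auto intro!: bdd_belowI2[where m = "a - d"])
  have "(INF y\<in>Y. G x y) \<le> b" if "x \<in> X" for x
    using cINF_lower[OF bddG[OF that] y0] upper[OF that y0] by linarith
  then have bdd: "bdd_above ((\<lambda>x. INF y\<in>Y. G x y) ` X)"
    by (auto intro!: bdd_aboveI2[where M = b])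
  show ?thesis
    unfolding maxmin_def
  proof (rule cSUP_least[OF \<open>X \<noteq> {}\<close>])
    fix x assume x: "x \<in> X"
    have "(INF y\<in>Y. F x y) - d \<le> (INF y\<in>Y. G x y)"
    proof (rule cINF_greatest[OF \<open>Y \<noteq> {}\<close>])
      fix y assume y: "y \<in> Y"
      show "(INF y\<in>Y. F x y) - d \<le> G x y"
        using cINF_lower[OF bddF[OF x] y] le[OF x y] by linarith
    qed
    also have "\<dots> \<le> (SUP x\<in>X. INF y\<in>Y. G x y)"
      by (rule cSUP_upper[OF x bdd])
    finally show "(INF y\<in>Y. F x y) \<le> (SUP x\<in>X. INF y\<in>Y. G x y) + d" by linarith
  qed
qed

lemma maxmin_const:
  assumes "X \<noteq> {}" "Y \<noteq> {}"
  shows "maxmin X Y (\<lambda>x y. b) = b"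
  using assms by (simp add: maxmin_def)

lemma maxmin_bounds:
  assumes "X \<noteq> {}" "Y \<noteq> {}"
    and "\<And>x y. x \<in> X \<Longrightarrow> y \<in> Y \<Longrightarrow> F x y \<in> {a..b}"
  shows "maxmin X Y F \<in> {a..b}"
  using maxmin_le_add[of X Y a F "\<lambda>x y. b" b 0] maxmin_le_add[of X Y a "\<lambda>x y. a" F b 0]
    maxmin_const[of X Y] assms by auto

lemma maxmin_diff_le:
  assumes "X \<noteq> {}" "Y \<noteq> {}"
    and F: "\<And>x y. x \<in> X \<Longrightarrow> y \<in> Y \<Longrightarrow> F x y \<in> {a..b}"
    and G: "\<And>x y. x \<in> X \<Longrightarrow> y \<in> Y \<Longrightarrow> G x y \<in> {a'..b'}"
    and d: "\<And>x y. x \<in> X \<Longrightarrow> y \<in> Y \<Longrightarrow> \<bar>F x y - G x y\<bar> \<le> d"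
  shows "\<bar>maxmin X Y F - maxmin X Y G\<bar> \<le> d"
proof -
  have "maxmin X Y F \<le> maxmin X Y G + d"
    by (rule maxmin_le_add[of _ _ a _ _ b']) (use assms in \<open>fastforce simp: abs_le_iff\<close>)+
  moreover have "maxmin X Y G \<le> maxmin X Y F + d"
    by (rule maxmin_le_add[of _ _ a' _ _ b]) (use assms in \<open>fastforce simp: abs_le_iff\<close>)+
  ultimately show ?thesis by linarith
qed

lemma maxmin_add_const:
  assumes "X \<noteq> {}" "Y \<noteq> {}"
    and F: "\<And>x y. x \<in> X \<Longrightarrow> y \<in> Y \<Longrightarrow> F x y \<in> {a..b}"
  shows "maxmin X Y (\<lambda>x y. F x y + d) = maxmin X Y F + d"
proof (rule antisym)
  show "maxmin X Y (\<lambda>x y. F x y + d) \<le> maxmin X Y F + d"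
    by (rule maxmin_le_add[of _ _ "a + d" _ _ b]) (use assms in auto)
  have "maxmin X Y F \<le> maxmin X Y (\<lambda>x y. F x y + d) + (- d)"
    by (rule maxmin_le_add[of _ _ a _ _ "b + d"]) (use assms in auto)
  then show "maxmin X Y F + d \<le> maxmin X Y (\<lambda>x y. F x y + d)" by simp
qed

text \<open>
  The supremum need not be attained here, since no continuity in \<open>x\<close> is available; an
  \<open>e\<close>-optimal choice always exists.
\<close>

lemma maxmin_near_optimal:
  assumes "X \<noteq> {}" "Y \<noteq> {}"
    and F: "\<And>x y. x \<in> X \<Longrightarrow> y \<in> Y \<Longrightarrow> a \<le> F x y"
    and e: "e > 0"
  obtains x where "x \<in> X" "\<And>y. y \<in> Y \<Longrightarrow> maxmin X Y F - e < F x y"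
proof -
  obtain x where x: "x \<in> X" "maxmin X Y F - e < (INF y\<in>Y. F x y)"
    using less_cSUP_iff[of X] less_cSupD[of "(\<lambda>x. INF y\<in>Y. F x y) ` X" "maxmin X Y F - e"]
      \<open>X \<noteq> {}\<close> e by (auto simp: maxmin_def)
  have "bdd_below (F x ` Y)"
    using F[OF x(1)] by (auto intro!: bdd_belowI2[where m = a])
  then have "maxmin X Y F - e < F x y" if "y \<in> Y" for y
    using cINF_lower[of "F x" Y y] that x by linarith
  with x(1) show ?thesis by (rule that)
qed

section \<open>Oscillation of almost subharmonic functions\<close>

lemma Prob_average_bounds:
  fixes d :: "real ^ 'e::finite"
  assumes "d \<in> Prob" "\<And>i. v i \<in> {a..b}"
  shows "(\<Sum>i\<in>UNIV. d $ i * v i) \<in> {a..b}"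
proof -
  have d: "\<And>i. 0 \<le> d $ i" "(\<Sum>i\<in>UNIV. d $ i) = 1" using assms(1) by (auto simp: Prob_def)
  have "(\<Sum>i\<in>UNIV. d $ i * a) \<le> (\<Sum>i\<in>UNIV. d $ i * v i)"
    "(\<Sum>i\<in>UNIV. d $ i * v i) \<le> (\<Sum>i\<in>UNIV. d $ i * b)"
    using d(1) assms(2) by (auto intro!: sum_mono mult_left_mono)
  then show ?thesis using d(2) by (simp flip: sum_distrib_right)
qed

lemma irreducible_kernel_reachable:
  fixes K :: "real ^ 's ^ 's::finite"
  assumes irr: "irreducible_kernel K" and nonneg: "\<And>s s'. 0 \<le> K $ s $ s'"
  shows "(s, s') \<in> {(s, s'). K $ s $ s' > 0}\<^sup>*"
proof -
  have Suc_entry: "kernel_power K (Suc n) $ s $ s' = (\<Sum>t\<in>UNIV. K $ s $ t * kernel_power K n $ t $ s')"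
    for n s s' by (simp add: kernel_power_def matrix_matrix_mult_def)
  have "(s, s') \<in> {(s, s'). K $ s $ s' > 0}\<^sup>*" if "kernel_power K n $ s $ s' > 0" for n s
    using that
  proof (induction n arbitrary: s)
    case 0
    then show ?case by (simp add: kernel_power_def mat_def split: if_splits)
  next
    case (Suc n)
    then obtain t where "K $ s $ t * kernel_power K n $ t $ s' > 0"
      by (metis (no_types, lifting) Suc_entry sum_nonpos not_le)
    then have "K $ s $ t > 0" "kernel_power K n $ t $ s' > 0"
      using nonneg[of s t] by (auto simp: zero_less_mult_iff)
    with Suc.IH show ?case by (auto intro: converse_rtrancl_into_rtrancl)
  qed
  then show ?thesis using irr unfolding irreducible_kernel_def by blast
qed

text \<open>
  The slack 2 is the sum of the largest stage reward and the loss from playing 1-optimally instead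
  of optimally.
\<close>

definition almost_subharmonic :: "('s \<Rightarrow> real ^ 's) \<Rightarrow> ('s \<Rightarrow> real) \<Rightarrow> bool" where
  "almost_subharmonic L u \<longleftrightarrow> (\<forall>s. u s \<le> 2 + (\<Sum>s'\<in>UNIV. L s $ s' * u s'))"

text \<open>
  Write \<open>d t\<close> for the defect \<open>u s - u t \<ge> 0\<close> below the maximum
  \<open>u s\<close>.  Almost subharmonicity at \<open>a\<close> says that the average of \<open>d\<close> over
  the successors of \<open>a\<close> is at most \<open>2 + d a\<close>, so a single successor \<open>b\<close>
  of probability at least \<open>\<delta>\<close> has \<open>d b \<le> (2 + d a) / \<delta>\<close>.  The bound
  depends only on the path and on \<open>\<delta>\<close>, which is what allows the kernel \<open>L\<close>
  to vary later.
\<close>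

lemma oscillation_bound_along_path:
  fixes E :: "('s::finite \<times> 's) set"
  assumes "(s, s') \<in> E\<^sup>*" and "\<delta> > 0"
  shows "\<exists>B. \<forall>L u. range L \<subseteq> Prob \<longrightarrow> (\<forall>(a, b) \<in> E. \<delta> \<le> L a $ b) \<longrightarrow>
    almost_subharmonic L u \<longrightarrow> (\<forall>a. u a \<le> u s) \<longrightarrow> u s - u s' \<le> B"
  using assms(1)
proof (induction rule: rtrancl_induct)
  case base
  show ?case by (intro exI[of _ 0]) auto
next
  case (step a b)
  then obtain B where B: "\<And>L u. range L \<subseteq> Prob \<Longrightarrow> \<forall>(a, b) \<in> E. \<delta> \<le> L a $ b \<Longrightarrow>
      almost_subharmonic L u \<Longrightarrow> \<forall>a. u a \<le> u s \<Longrightarrow> u s - u a \<le> B" by blast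
  show ?case
  proof (intro exI[of _ "(2 + B) / \<delta>"] allI impI)
    fix L :: "'s \<Rightarrow> real ^ 's" and u
    assume L: "range L \<subseteq> Prob" "\<forall>(a, b) \<in> E. \<delta> \<le> L a $ b" and u: "almost_subharmonic L u"
      and top: "\<forall>a. u a \<le> u s"
    have Prob: "0 \<le> L a $ t" "(\<Sum>t\<in>UNIV. L a $ t) = 1" for t
      using L(1) by (auto simp: Prob_def image_subset_iff)
    have "\<delta> * (u s - u b) \<le> L a $ b * (u s - u b)"
      using L(2) step.hyps top by (auto intro!: mult_right_mono)
    also have "\<dots> \<le> (\<Sum>t\<in>UNIV. L a $ t * (u s - u t))"
      by (rule member_le_sum) (use Prob top in auto)
    also have "\<dots> = u s - (\<Sum>t\<in>UNIV. L a $ t * u t)"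
      using Prob(2) by (simp add: right_diff_distrib sum_subtractf flip: sum_distrib_right)
    also have "\<dots> \<le> 2 + (u s - u a)"
      using u[unfolded almost_subharmonic_def, rule_format, of a] by linarith
    also have "\<dots> \<le> 2 + B" using B[OF L u top] by simp
    finally show "u s - u b \<le> (2 + B) / \<delta>"
      using \<open>\<delta> > 0\<close> by (simp add: pos_le_divide_eq mult.commute)
  qed
qed

text \<open>
  \<open>K\<close> only supplies the paths; the bound holds for all kernels \<open>L\<close> that give
  probability at least \<open>\<delta>\<close> to each transition possible under \<open>K\<close>.
\<close>

lemma oscillation_bound_irreducible:
  fixes K :: "real ^ 's ^ 's::finite"
  assumes irr: "irreducible_kernel K" and nonneg: "\<And>s s'. 0 \<le> K $ s $ s'" and "\<delta> > 0"
  shows "\<exists>B. \<forall>L u. range L \<subseteq> Prob \<longrightarrow> (\<forall>a b. K $ a $ b > 0 \<longrightarrow> \<delta> \<le> L a $ b) \<longrightarrow>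
    almost_subharmonic L u \<longrightarrow> (\<forall>s s'. u s - u s' \<le> B)"
proof -
  have "\<forall>s s'. \<exists>B. \<forall>L u. range L \<subseteq> Prob \<longrightarrow> (\<forall>a b. K $ a $ b > 0 \<longrightarrow> \<delta> \<le> L a $ b) \<longrightarrow>
      almost_subharmonic L u \<longrightarrow> (\<forall>a. u a \<le> u s) \<longrightarrow> u s - u s' \<le> B"
    using oscillation_bound_along_path[OF irreducible_kernel_reachable[OF irr nonneg] \<open>\<delta> > 0\<close>]
    by simp
  then obtain B where B: "\<And>s s' L u. range L \<subseteq> Prob \<Longrightarrow> \<forall>a b. K $ a $ b > 0 \<longrightarrow> \<delta> \<le> L a $ b \<Longrightarrow>
      almost_subharmonic L u \<Longrightarrow> \<forall>a. u a \<le> u s \<Longrightarrow> u s - u s' \<le> B s s'" by metis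
  \<comment> \<open>The states where \<open>u\<close> is largest and smallest depend on \<open>u\<close>, so the bounds are
    maximised over all pairs.\<close>
  show ?thesis
  proof (intro exI[of _ "Max (range (case_prod B))"] allI impI)
    fix L :: "'s \<Rightarrow> real ^ 's" and u s s'
    assume L: "range L \<subseteq> Prob" "\<forall>a b. K $ a $ b > 0 \<longrightarrow> \<delta> \<le> L a $ b"
      and u: "almost_subharmonic L u"
    have "Max (range u) \<in> range u" by (rule Max_in) auto
    then obtain t where "Max (range u) = u t" by blast
    then have t: "\<forall>a. u a \<le> u t" by (metis Max_ge finite finite_imageI rangeI)
    have "u s - u s' \<le> u t - u s'" using t by simp
    also have "\<dots> \<le> B t s'" by (rule B[OF L u t])
    also have "\<dots> \<le> Max (range (case_prod B))"
      by (rule Max_ge) (auto intro: range_eqI[of _ _ "(t, s')"])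
    finally show "u s - u s' \<le> Max (range (case_prod B))" .
  qed
qed

section \<open>Games in which every outer policy has an irreducible reply\<close>

lemma compact_Pi_UNIV:
  assumes "\<And>i. compact (X i)"
  shows "compact (Pi UNIV X)"
  using compactin_PiE[of "\<lambda>_. euclidean" UNIV X] assms
  by (simp add: euclidean_product_topology PiE_UNIV_domain)

text \<open>
  \<open>X s\<close> belongs to the outer, maximising player and \<open>Y s\<close> to the inner one;
  \<open>c s x y\<close> is the stage reward and \<open>w s x y\<close> the distribution of the next state.
  Policies are functions on states, so that their space \<open>Pi UNIV X\<close> is compact in the
  product topology.
\<close>

locale stochastic_game =
  fixes X :: "'s::finite \<Rightarrow> 'x::topological_space set"
    and Y :: "'s \<Rightarrow> 'y set"
    and c :: "'s \<Rightarrow> 'x \<Rightarrow> 'y \<Rightarrow> real"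
    and w :: "'s \<Rightarrow> 'x \<Rightarrow> 'y \<Rightarrow> real ^ 's"
  assumes X_nonempty: "X s \<noteq> {}" and Y_nonempty: "Y s \<noteq> {}"
    and X_compact: "compact (X s)"
    and c_bounds: "x \<in> X s \<Longrightarrow> y \<in> Y s \<Longrightarrow> c s x y \<in> {0..1}"
    and w_Prob: "x \<in> X s \<Longrightarrow> y \<in> Y s \<Longrightarrow> w s x y \<in> Prob"
    and w_continuous: "y \<in> Y s \<Longrightarrow> continuous_on (X s) (\<lambda>x. w s x y)"
    and irreducible_response: "\<xi> \<in> Pi UNIV X \<Longrightarrow>
      \<exists>\<eta> \<in> Pi UNIV Y. irreducible_kernel (\<chi> s. w s (\<xi> s) (\<eta> s))"
begin

definition payoff :: "('s \<Rightarrow> real) \<Rightarrow> 's \<Rightarrow> 'x \<Rightarrow> 'y \<Rightarrow> real" where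
  "payoff u s x y = c s x y + (\<Sum>s'\<in>UNIV. w s x y $ s' * u s')"

definition shapley :: "('s \<Rightarrow> real) \<Rightarrow> 's \<Rightarrow> real" where
  "shapley u s = maxmin (X s) (Y s) (payoff u s)"

text \<open>What \<open>u \<le> T u\<close> leaves after an outer policy \<open>\<xi>\<close> has been fixed: the
  inequality survives every reply, in particular an irreducible one.\<close>

definition robustly_subharmonic :: "('s \<Rightarrow> 'x) \<Rightarrow> ('s \<Rightarrow> real) \<Rightarrow> bool" where
  "robustly_subharmonic \<xi> u \<longleftrightarrow>
     (\<forall>\<eta> \<in> Pi UNIV Y. almost_subharmonic (\<lambda>s. w s (\<xi> s) (\<eta> s)) u)"

lemma payoff_bounds:
  assumes "x \<in> X s" "y \<in> Y s" "\<And>t. u t \<in> {a..b}"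
  shows "payoff u s x y \<in> {a..b + 1}"
  using c_bounds[OF assms(1,2)] Prob_average_bounds[where v = u, OF w_Prob[OF assms(1,2)] assms(3)]
  by (auto simp: payoff_def)

lemma payoff_bounds_Min_Max:
  assumes "x \<in> X s" "y \<in> Y s"
  shows "payoff u s x y \<in> {Min (range u)..Max (range u) + 1}"
  using assms by (rule payoff_bounds) auto

lemma shapley_bounds:
  assumes "\<And>t. u t \<in> {a..b}"
  shows "shapley u s \<in> {a..b + 1}"
  unfolding shapley_def
  by (rule maxmin_bounds[OF X_nonempty Y_nonempty payoff_bounds[OF _ _ assms]])

lemma shapley_nonexpansive:
  assumes "\<And>t. \<bar>u t - v t\<bar> \<le> d"
  shows "\<bar>shapley u s - shapley v s\<bar> \<le> d"
  unfolding shapley_def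
proof (rule maxmin_diff_le[OF X_nonempty Y_nonempty payoff_bounds_Min_Max payoff_bounds_Min_Max])
  fix x y assume xy: "x \<in> X s" "y \<in> Y s"
  have "(\<Sum>t\<in>UNIV. w s x y $ t * (u t - v t)) \<in> {- d..d}"
    by (rule Prob_average_bounds[OF w_Prob[OF xy]]) (use assms in \<open>auto simp: abs_le_iff, smt (verit)\<close>)
  then show "\<bar>payoff u s x y - payoff v s x y\<bar> \<le> d"
    by (auto simp: payoff_def right_diff_distrib sum_subtractf abs_le_iff)
qed

text \<open>
  Fix an irreducible reply \<open>\<eta>\<close> to \<open>\<xi>\<close> and let \<open>\<delta>\<close> be half its
  smallest positive transition probability.  Keeping \<open>\<eta>\<close> while \<open>\<zeta>\<close> moves near
  \<open>\<xi>\<close>, all these transitions retain probability at least \<open>\<delta>\<close> by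
  continuity, and the path argument applies with one bound for the whole neighbourhood.
\<close>

lemma locally_uniform_oscillation_bound:
  assumes \<xi>: "\<xi> \<in> Pi UNIV X"
  obtains U B where "open U" "\<xi> \<in> U"
    "\<And>\<zeta> u s s'. \<zeta> \<in> U \<Longrightarrow> \<zeta> \<in> Pi UNIV X \<Longrightarrow>
      robustly_subharmonic \<zeta> u \<Longrightarrow> u s - u s' \<le> B"
proof -
  obtain \<eta> where \<eta>: "\<eta> \<in> Pi UNIV Y" and irr: "irreducible_kernel (\<chi> s. w s (\<xi> s) (\<eta> s))"
    using irreducible_response[OF \<xi>] by blast
  have Prob: "w s (\<zeta> s) (\<eta> s) \<in> Prob" if "\<zeta> \<in> Pi UNIV X" for \<zeta> s
    using w_Prob that \<eta> by blast
  define E where "E = {(s, s'). w s (\<xi> s) (\<eta> s) $ s' > 0}"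
  \<comment> \<open>Inserting 1 keeps the set nonempty without having to exhibit an edge.\<close>
  define \<delta> where "\<delta> = Min (insert 1 ((\<lambda>(s, s'). w s (\<xi> s) (\<eta> s) $ s') ` E)) / 2"
  have \<delta>: "\<delta> > 0" by (auto simp: \<delta>_def E_def)
  have edge: "\<delta> < w s (\<xi> s) (\<eta> s) $ s'" if "(s, s') \<in> E" for s s'
  proof -
    have "2 * \<delta> \<le> w s (\<xi> s) (\<eta> s) $ s'"
      unfolding \<delta>_def using that by (auto intro!: Min_le)
    with \<delta> show ?thesis by linarith
  qed
  have "\<forall>\<^sub>F \<zeta> in at \<xi> within Pi UNIV X. \<delta> < w s (\<zeta> s) (\<eta> s) $ s'" if "(s, s') \<in> E" for s s'
  proof -
    have "continuous_on (Pi UNIV X) (\<lambda>\<zeta>. w s (\<zeta> s) (\<eta> s))"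
      by (rule continuous_on_compose2[OF w_continuous[of "\<eta> s" s]])
        (use \<eta> in \<open>auto intro: continuous_on_subset[OF continuous_on_product_coordinates]\<close>)
    then have "continuous_on (Pi UNIV X) (\<lambda>\<zeta>. w s (\<zeta> s) (\<eta> s) $ s')"
      by (rule continuous_on_component)
    then have "((\<lambda>\<zeta>. w s (\<zeta> s) (\<eta> s) $ s') \<longlongrightarrow> w s (\<xi> s) (\<eta> s) $ s') (at \<xi> within Pi UNIV X)"
      using \<xi> unfolding continuous_on_def by blast
    then show ?thesis using edge[OF that] by (rule order_tendstoD)
  qed
  then have "\<forall>\<^sub>F \<zeta> in at \<xi> within Pi UNIV X. \<forall>e\<in>E. \<delta> < w (fst e) (\<zeta> (fst e)) (\<eta> (fst e)) $ snd e"
    by (intro eventually_ball_finite) auto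
  then obtain U where U: "open U" "\<xi> \<in> U"
    and near: "\<And>\<zeta>. \<zeta> \<in> U \<Longrightarrow> \<zeta> \<noteq> \<xi> \<Longrightarrow> \<zeta> \<in> Pi UNIV X \<Longrightarrow>
      \<forall>e\<in>E. \<delta> < w (fst e) (\<zeta> (fst e)) (\<eta> (fst e)) $ snd e"
    unfolding eventually_at_topological by blast
  have nonneg: "0 \<le> (\<chi> s. w s (\<xi> s) (\<eta> s)) $ s $ s'" for s s'
    using Prob[OF \<xi>, of s] by (simp add: Prob_def)
  obtain B where "\<forall>L u. range L \<subseteq> Prob \<longrightarrow> (\<forall>a b. (a, b) \<in> E \<longrightarrow> \<delta> \<le> L a $ b) \<longrightarrow>
      almost_subharmonic L u \<longrightarrow> (\<forall>s s'. u s - u s' \<le> B)"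
    using oscillation_bound_irreducible[OF irr nonneg \<delta>] by (auto simp: E_def)
  then have B: "\<And>L u s s'. range L \<subseteq> Prob \<Longrightarrow> (\<And>a b. (a, b) \<in> E \<Longrightarrow> \<delta> \<le> L a $ b) \<Longrightarrow>
      almost_subharmonic L u \<Longrightarrow> u s - u s' \<le> B" by blast
  show ?thesis
  proof (rule that[OF U])
    fix \<zeta> u s s'
    assume \<zeta>: "\<zeta> \<in> U" "\<zeta> \<in> Pi UNIV X"
      and u: "robustly_subharmonic \<zeta> u"
    have "\<delta> \<le> w a (\<zeta> a) (\<eta> a) $ b" if "(a, b) \<in> E" for a b
      using near[OF \<zeta>(1) _ \<zeta>(2)] edge that by (cases "\<zeta> = \<xi>") (fastforce intro: less_imp_le)+
    moreover have "range (\<lambda>s. w s (\<zeta> s) (\<eta> s)) \<subseteq> Prob" using Prob[OF \<zeta>(2)] by blast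
    moreover have "almost_subharmonic (\<lambda>s. w s (\<zeta> s) (\<eta> s)) u"
      using u \<eta> by (simp add: robustly_subharmonic_def)
    ultimately show "u s - u s' \<le> B"
      using B[of "\<lambda>s. w s (\<zeta> s) (\<eta> s)"] by blast
  qed
qed

lemma uniform_oscillation_bound:
  obtains B where "\<And>\<zeta> u s s'. \<zeta> \<in> Pi UNIV X \<Longrightarrow>
      robustly_subharmonic \<zeta> u \<Longrightarrow> u s - u s' \<le> B"
proof -
  have "\<forall>\<xi>\<in>Pi UNIV X. \<exists>U B. open U \<and> \<xi> \<in> U \<and> (\<forall>\<zeta> u s s'. \<zeta> \<in> U \<longrightarrow> \<zeta> \<in> Pi UNIV X \<longrightarrow>
      robustly_subharmonic \<zeta> u \<longrightarrow> u s - u s' \<le> B)" (is "\<forall>\<xi>\<in>_. ?bound \<xi>")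
  proof
    fix \<xi> assume "\<xi> \<in> Pi UNIV X"
    then obtain U B where "open U" "\<xi> \<in> U" "\<And>\<zeta> u s s'. \<zeta> \<in> U \<Longrightarrow> \<zeta> \<in> Pi UNIV X \<Longrightarrow>
        robustly_subharmonic \<zeta> u \<Longrightarrow> u s - u s' \<le> B"
      using locally_uniform_oscillation_bound by blast
    then show "?bound \<xi>" by blast
  qed
  from bchoice[OF this] obtain U where "\<forall>\<xi>\<in>Pi UNIV X. \<exists>B. open (U \<xi>) \<and> \<xi> \<in> U \<xi> \<and>
      (\<forall>\<zeta> u s s'. \<zeta> \<in> U \<xi> \<longrightarrow> \<zeta> \<in> Pi UNIV X \<longrightarrow> robustly_subharmonic \<zeta> u \<longrightarrow> u s - u s' \<le> B)" ..
  from bchoice[OF this] obtain B where UB: "\<forall>\<xi>\<in>Pi UNIV X. open (U \<xi>) \<and> \<xi> \<in> U \<xi> \<and>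
      (\<forall>\<zeta> u s s'. \<zeta> \<in> U \<xi> \<longrightarrow> \<zeta> \<in> Pi UNIV X \<longrightarrow> robustly_subharmonic \<zeta> u \<longrightarrow> u s - u s' \<le> B \<xi>)" ..
  then have U: "\<And>\<xi>. \<xi> \<in> Pi UNIV X \<Longrightarrow> open (U \<xi>) \<and> \<xi> \<in> U \<xi>" by blast
  obtain D where D: "D \<subseteq> Pi UNIV X" "finite D" "Pi UNIV X \<subseteq> (\<Union>\<xi>\<in>D. U \<xi>)"
  proof (rule compactE_image[of "Pi UNIV X" "Pi UNIV X" U])
    show "compact (Pi UNIV X)" by (rule compact_Pi_UNIV[OF X_compact])
    show "open (U \<xi>)" if "\<xi> \<in> Pi UNIV X" for \<xi> using U[OF that] ..
    show "Pi UNIV X \<subseteq> (\<Union>\<xi>\<in>Pi UNIV X. U \<xi>)"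
      using U by (intro subsetI UN_I) (assumption, rule conjunct2)
  qed
  show ?thesis
  proof (rule that[of "Max (insert 0 (B ` D))"])
    fix \<zeta> u s s'
    assume \<zeta>: "\<zeta> \<in> Pi UNIV X"
      and u: "robustly_subharmonic \<zeta> u"
    obtain \<xi> where \<xi>: "\<xi> \<in> D" "\<zeta> \<in> U \<xi>" using D(3) \<zeta> by blast
    have "u s - u s' \<le> B \<xi>" using UB \<xi> \<zeta> u D(1) by blast
    also have "\<dots> \<le> Max (insert 0 (B ` D))" using \<xi>(1) D(2) by (intro Max_ge) auto
    finally show "u s - u s' \<le> Max (insert 0 (B ` D))" .
  qed
qed

lemma robustly_subharmonic_if_le_shapley:
  assumes "\<And>s. u s \<le> shapley u s"
  obtains \<zeta> where "\<zeta> \<in> Pi UNIV X"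
    "robustly_subharmonic \<zeta> u"
proof -
  have "\<exists>x\<in>X s. \<forall>y\<in>Y s. u s - 1 \<le> payoff u s x y" for s
  proof -
    obtain x where "x \<in> X s" "\<And>y. y \<in> Y s \<Longrightarrow> shapley u s - 1 < payoff u s x y"
      unfolding shapley_def
      by (rule maxmin_near_optimal[OF X_nonempty Y_nonempty, of s s "Min (range u)" "payoff u s" 1])
        (use payoff_bounds_Min_Max[of _ s _ u] in auto)
    with assms[of s] show ?thesis by (smt (verit))
  qed
  then obtain \<zeta> where \<zeta>: "\<And>s. \<zeta> s \<in> X s" "\<And>s y. y \<in> Y s \<Longrightarrow> u s - 1 \<le> payoff u s (\<zeta> s) y"
    by metis
  show ?thesis
  proof (rule that)
    show "\<zeta> \<in> Pi UNIV X" using \<zeta>(1) by blast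
    show "robustly_subharmonic \<zeta> u"
      unfolding robustly_subharmonic_def almost_subharmonic_def
    proof (intro ballI allI)
      fix \<eta> s assume "\<eta> \<in> Pi UNIV Y"
      then have \<eta>: "\<And>s. \<eta> s \<in> Y s" by blast
      show "u s \<le> 2 + (\<Sum>s'\<in>UNIV. w s (\<zeta> s) (\<eta> s) $ s' * u s')"
        using \<zeta>(2)[OF \<eta>, of s] c_bounds[OF \<zeta>(1) \<eta>, of s] by (simp add: payoff_def)
    qed
  qed
qed

text \<open>
  The cap \<open>C\<close> is there to confine the map to a compact cube; subtracting the minimum
  \<open>m u\<close> normalises the fixed point to have minimum 0.
\<close>

theorem shapley_eigenvector:
  obtains u \<alpha> where "\<alpha> \<in> {0..1}" "\<And>s. shapley u s = u s + \<alpha>"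
proof -
  obtain B where B: "\<And>\<zeta> u s s'. \<zeta> \<in> Pi UNIV X \<Longrightarrow>
      robustly_subharmonic \<zeta> u \<Longrightarrow> u s - u s' \<le> B"
    using uniform_oscillation_bound by blast
  define C where "C = max B 0 + 1"
  define m where "m u = Min (range (shapley u))" for u
  define F :: "real ^ 's \<Rightarrow> real ^ 's" where
    "F v = (\<chi> s. min (shapley (($) v) s - m (($) v)) C)" for v
  have C: "B < C" "0 < C" by (auto simp: C_def)
  have m_le: "m u \<le> shapley u s" for u s by (simp add: m_def)
  have m_attained: "\<exists>s. m u = shapley u s" for u
  proof -
    have "Min (range (shapley u)) \<in> range (shapley u)" by (rule Min_in) auto
    then show ?thesis unfolding m_def by blast
  qed
  have m_nonexp: "\<bar>m u - m v\<bar> \<le> d" if "\<And>t. \<bar>u t - v t\<bar> \<le> d" for u v d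
  proof -
    obtain s t where "m u = shapley u s" "m v = shapley v t" using m_attained by metis
    then show ?thesis
      using shapley_nonexpansive[of u v d, OF that, of s] shapley_nonexpansive[of u v d, OF that, of t]
        m_le[of u t] m_le[of v s] by linarith
  qed
  have F_lip: "\<bar>F v $ s - F v' $ s\<bar> \<le> 2 * norm (v - v')" for v v' s
  proof -
    have close: "\<bar>v $ t - v' $ t\<bar> \<le> norm (v - v')" for t
      using component_le_norm_cart[of "v - v'" t] by simp
    show ?thesis
      using shapley_nonexpansive[of "($) v" "($) v'", OF close, of s]
        m_nonexp[of "($) v" "($) v'", OF close]
      by (simp add: F_def)
  qed
  have "continuous_on UNIV (\<lambda>v. F v $ s)" for s
  proof (rule continuous_on_subset[OF lipschitz_on_continuous_on[of 2 UNIV]])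
    show "2-lipschitz_on UNIV (\<lambda>v. F v $ s)"
      using F_lip by (intro lipschitz_onI) (auto simp: dist_norm)
  qed simp
  then have F_cont: "continuous_on UNIV F"
    using continuous_on_vec_lambda[of UNIV "\<lambda>s v. F v $ s"] by simp
  define S where "S = cbox (0 :: real ^ 's) (\<chi> s. C)"
  have "F v \<in> S" for v
    using C m_le by (auto simp: S_def mem_box_cart F_def)
  moreover have "0 \<in> S" using C by (auto simp: S_def mem_box_cart)
  ultimately obtain v where "v \<in> S" and fixv: "F v = v"
    using brouwer[of S F] continuous_on_subset[OF F_cont, of S] by (auto simp: S_def)
  define u where "u = ($) v"
  have u: "u s = min (shapley u s - m u) C" for s
    using fixv unfolding u_def F_def by (metis vec_lambda_beta)
  have u_nonneg: "0 \<le> u s" for s using u[of s] m_le[of u s] C by simp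
  obtain s0 where "m u = shapley u s0" using m_attained by blast
  then have s0: "u s0 = 0" using u[of s0] C by simp
  have m_nonneg: "0 \<le> m u"
    using shapley_bounds[of u 0 "Max (range u)" s0] u_nonneg \<open>m u = shapley u s0\<close> by simp
  \<comment> \<open>This inequality holds whether or not the cap is active at \<open>s\<close>, so the oscillation bound
    can be used to exclude that it is active.\<close>
  have "u s \<le> shapley u s" for s using u[of s] m_nonneg by linarith
  then obtain \<zeta> where "\<zeta> \<in> Pi UNIV X"
    "robustly_subharmonic \<zeta> u"
    by (rule robustly_subharmonic_if_le_shapley)
  then have "u s - u s0 \<le> B" for s by (rule B)
  then have "u s < C" for s using s0 C(1) by (smt (verit))
  then have eig: "shapley u s = u s + m u" for s using u[of s] by (smt (verit))
  have "Max (range u) \<in> range u" by (rule Max_in) auto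
  then obtain s1 where "Max (range u) = u s1" by blast
  moreover have "shapley u s1 \<in> {0..Max (range u) + 1}"
    by (rule shapley_bounds) (use u_nonneg in auto)
  ultimately have "m u \<le> 1" using eig[of s1] by simp
  with m_nonneg eig show ?thesis by (intro that[of "m u" u]) auto
qed

lemma constant_gain_equation:
  obtains u \<alpha> where "\<alpha> \<in> {0..1}"
    "\<And>s. u s = (SUP x\<in>X s. INF y\<in>Y s. c s x y - \<alpha> + (\<Sum>s'\<in>UNIV. w s x y $ s' * u s'))"
proof -
  obtain u \<alpha> where \<alpha>: "\<alpha> \<in> {0..1}" and eig: "\<And>s. shapley u s = u s + \<alpha>"
    using shapley_eigenvector by blast
  have "u s = (SUP x\<in>X s. INF y\<in>Y s. c s x y - \<alpha> + (\<Sum>s'\<in>UNIV. w s x y $ s' * u s'))" for s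
  proof -
    have "maxmin (X s) (Y s) (\<lambda>x y. payoff u s x y + (- \<alpha>)) = shapley u s + (- \<alpha>)"
      unfolding shapley_def
      by (rule maxmin_add_const[OF X_nonempty Y_nonempty payoff_bounds_Min_Max])
    moreover have "payoff u s x y + (- \<alpha>) = c s x y - \<alpha> + (\<Sum>s'\<in>UNIV. w s x y $ s' * u s')" for x y
      by (simp add: payoff_def)
    ultimately have "(SUP x\<in>X s. INF y\<in>Y s. c s x y - \<alpha> + (\<Sum>s'\<in>UNIV. w s x y $ s' * u s'))
        = shapley u s + (- \<alpha>)"
      by (simp only: maxmin_def)
    then show ?thesis using eig[of s] by linarith
  qed
  with \<alpha> show ?thesis by (rule that)
qed

end

section \<open>The robust Bellman equations\<close>

definition mixed_reward :: "('s \<Rightarrow> 'a::finite \<Rightarrow> real) \<Rightarrow> 's \<Rightarrow> real ^ 'a \<Rightarrow> real" where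
  "mixed_reward r s \<phi> = (\<Sum>a\<in>UNIV. \<phi> $ a * r s a)"

definition mixed_transition :: "real ^ 'a::finite \<Rightarrow> real ^ 's ^ 'a \<Rightarrow> real ^ 's::finite" where
  "mixed_transition \<phi> q = (\<chi> s'. \<Sum>a\<in>UNIV. q $ a $ s' * \<phi> $ a)"

lemma policy_kernel_eq: "policy_kernel p \<Delta> = (\<chi> s. mixed_transition (\<Delta> s) (p s))"
  by (simp add: policy_kernel_def mixed_transition_def vec_eq_iff)

lemma mixed_transition_Prob:
  assumes \<phi>: "\<phi> \<in> Prob" and q: "\<And>a. q $ a \<in> Prob"
  shows "mixed_transition \<phi> q \<in> Prob"
proof -
  have "(\<Sum>s'\<in>UNIV. \<Sum>a\<in>UNIV. q $ a $ s' * \<phi> $ a) = (\<Sum>a\<in>UNIV. \<Sum>s'\<in>UNIV. q $ a $ s' * \<phi> $ a)"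
    by (rule sum.swap)
  also have "\<dots> = 1" using \<phi> q by (simp add: Prob_def flip: sum_distrib_right)
  finally show ?thesis
    using \<phi> q by (auto simp: Prob_def mixed_transition_def intro!: sum_nonneg)
qed

lemma mixed_reward_bounds:
  assumes "\<phi> \<in> Prob" "\<And>a. r s a \<in> {0..1}"
  shows "mixed_reward r s \<phi> \<in> {0..1}"
  unfolding mixed_reward_def using assms by (rule Prob_average_bounds)

lemma bellman_term_eq:
  assumes \<phi>: "\<phi> \<in> Prob" and q: "\<And>a. q $ a \<in> Prob"
  shows "bellman_term r \<alpha> u s \<phi> q =
    mixed_reward r s \<phi> - \<alpha> + (\<Sum>s'\<in>UNIV. mixed_transition \<phi> q $ s' * u s')"
proof -
  have "bellman_term r \<alpha> u s \<phi> q = (\<Sum>a\<in>UNIV. \<phi> $ a * (r s a - \<alpha>) * (\<Sum>s'\<in>UNIV. q $ a $ s'))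
      + (\<Sum>a\<in>UNIV. \<Sum>s'\<in>UNIV. q $ a $ s' * \<phi> $ a * u s')"
    unfolding bellman_term_def sum_distrib_left sum.distrib[symmetric]
    by (simp add: algebra_simps)
  also have "(\<Sum>a\<in>UNIV. \<Sum>s'\<in>UNIV. q $ a $ s' * \<phi> $ a * u s')
      = (\<Sum>s'\<in>UNIV. mixed_transition \<phi> q $ s' * u s')"
    unfolding mixed_transition_def by (subst sum.swap) (simp add: sum_distrib_right)
  also have "(\<Sum>a\<in>UNIV. \<phi> $ a * (r s a - \<alpha>) * (\<Sum>s'\<in>UNIV. q $ a $ s')) = mixed_reward r s \<phi> - \<alpha>"
    using \<phi> q by (simp add: Prob_def mixed_reward_def right_diff_distrib sum_subtractf
        flip: sum_distrib_right)
  finally show ?thesis .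
qed

theorem corollary7p1:
  fixes r :: "'s::finite \<Rightarrow> 'a::finite \<Rightarrow> real"
    and Q :: "(real ^ 'a) set"
    and P :: "'s \<Rightarrow> (real ^ 's ^ 'a) set"
  assumes "\<forall>s a. r s a \<in> {0..1}"
    and "Q \<noteq> {}" and "Q \<subseteq> Prob"
    and "\<forall>s. P s \<noteq> {}" and "\<forall>s. \<forall>q\<in>P s. \<forall>a. q $ a \<in> Prob"
  shows "(compact Q \<and>
          (\<forall>\<Delta> \<in> UNIV \<rightarrow> Q. \<exists>p \<in> Pi UNIV P. irreducible_kernel (policy_kernel p \<Delta>))
            \<longrightarrow> (\<exists>u \<alpha>. \<alpha> \<in> {0..1} \<and> sup_inf_solution Q P r u \<alpha>)) \<and>
         ((\<forall>s. compact (P s)) \<and>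
          (\<forall>p \<in> Pi UNIV P. \<exists>\<Delta> \<in> UNIV \<rightarrow> Q. irreducible_kernel (policy_kernel p \<Delta>))
            \<longrightarrow> (\<exists>u \<alpha>. \<alpha> \<in> {0..1} \<and> inf_sup_solution Q P r u \<alpha>))"
proof (intro conjI impI; elim conjE)
  have reward: "mixed_reward r s \<phi> \<in> {0..1}" if "\<phi> \<in> Q" for s \<phi>
    using mixed_reward_bounds[of \<phi> r s] assms(1,3) that by blast
  have transition: "mixed_transition \<phi> q \<in> Prob" if "\<phi> \<in> Q" "q \<in> P s" for \<phi> q s
    using mixed_transition_Prob[of \<phi> q] assms(3,5) that by blast
  have bellman: "bellman_term r \<alpha> u s \<phi> q =
      mixed_reward r s \<phi> - \<alpha> + (\<Sum>s'\<in>UNIV. mixed_transition \<phi> q $ s' * u s')"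
    if "\<phi> \<in> Q" "q \<in> P s" for \<alpha> u s \<phi> q
    using bellman_term_eq[of \<phi> q] assms(3,5) that by blast
  {
    assume "compact Q"
      and irr: "\<forall>\<Delta> \<in> UNIV \<rightarrow> Q. \<exists>p \<in> Pi UNIV P. irreducible_kernel (policy_kernel p \<Delta>)"
    interpret stochastic_game "\<lambda>_. Q" P "\<lambda>s \<phi> q. mixed_reward r s \<phi>"
      "\<lambda>s. mixed_transition"
    proof
      show "continuous_on Q (\<lambda>\<phi>. mixed_transition \<phi> q)" for q :: "real ^ 's ^ 'a"
        unfolding mixed_transition_def by (intro continuous_intros)
    qed (use assms(2,4) \<open>compact Q\<close> irr reward transition in \<open>auto simp: policy_kernel_eq\<close>)
    obtain u \<alpha> where \<alpha>: "\<alpha> \<in> {0..1}" and u: "\<And>s. u s = (SUP \<phi>\<in>Q. INF q\<in>P s.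
        mixed_reward r s \<phi> - \<alpha> + (\<Sum>s'\<in>UNIV. mixed_transition \<phi> q $ s' * u s'))"
      by (rule constant_gain_equation) blast
    have "sup_inf_solution Q P r u \<alpha>"
      unfolding sup_inf_solution_def
    proof
      fix s
      show "u s = (SUP \<phi>\<in>Q. INF q\<in>P s. bellman_term r \<alpha> u s \<phi> q)"
        using bellman by (subst u) (auto intro!: SUP_cong INF_cong)
    qed
    with \<alpha> show "\<exists>u \<alpha>. \<alpha> \<in> {0..1} \<and> sup_inf_solution Q P r u \<alpha>" by blast
  next
    assume "\<forall>s. compact (P s)"
      and irr: "\<forall>p \<in> Pi UNIV P. \<exists>\<Delta> \<in> UNIV \<rightarrow> Q. irreducible_kernel (policy_kernel p \<Delta>)"
    \<comment> \<open>Nature is the outer player and maximises; \<open>1 - r\<close> rather than \<open>- r\<close> keeps stage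
      rewards in the unit interval.\<close>
    interpret stochastic_game P "\<lambda>_. Q" "\<lambda>s q \<phi>. 1 - mixed_reward r s \<phi>"
      "\<lambda>s q \<phi>. mixed_transition \<phi> q"
    proof
      show "continuous_on (P s) (mixed_transition \<phi>)" for s \<phi>
        unfolding mixed_transition_def by (intro continuous_intros)
      show "1 - mixed_reward r s \<phi> \<in> {0..1}" if "\<phi> \<in> Q" for s \<phi>
        using reward[OF that, of s] by simp
    qed (use assms(2,4) \<open>\<forall>s. compact (P s)\<close> irr transition in \<open>auto simp: policy_kernel_eq\<close>)
    obtain v \<beta> where \<beta>: "\<beta> \<in> {0..1}" and v: "\<And>s. v s = (SUP q\<in>P s. INF \<phi>\<in>Q.
        1 - mixed_reward r s \<phi> - \<beta> + (\<Sum>s'\<in>UNIV. mixed_transition \<phi> q $ s' * v s'))"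
      by (rule constant_gain_equation) blast
    define u where "u s = - v s" for s
    have neg: "1 - mixed_reward r s \<phi> - \<beta> + (\<Sum>s'\<in>UNIV. mixed_transition \<phi> q $ s' * v s')
        = - bellman_term r (1 - \<beta>) u s \<phi> q" if "\<phi> \<in> Q" "q \<in> P s" for s \<phi> q
      using bellman[OF that] by (simp add: u_def sum_negf)
    have "inf_sup_solution Q P r u (1 - \<beta>)"
      unfolding inf_sup_solution_def
    proof
      fix s
      have "v s = (SUP q\<in>P s. INF \<phi>\<in>Q. - bellman_term r (1 - \<beta>) u s \<phi> q)"
        using neg by (subst v) (auto intro!: SUP_cong INF_cong)
      \<comment> \<open>Real infima are defined as negated suprema of negations, so this exchange of signs is
        unconditional.\<close>
      then show "u s = (INF q\<in>P s. SUP \<phi>\<in>Q. bellman_term r (1 - \<beta>) u s \<phi> q)"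
        by (simp add: u_def Inf_real_def image_image)
    qed
    moreover have "1 - \<beta> \<in> {0..1}" using \<beta> by simp
    ultimately show "\<exists>u \<alpha>. \<alpha> \<in> {0..1} \<and> inf_sup_solution Q P r u \<alpha>" by blast
  }
qed

end
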